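(* Suppose that $X$ is an unbounded path metric space which is not quasi-isometric to $\mathbb{R}_+$ or to $\mathbb{R}$. Then: 1. $K_3(X)$ contains the interior of the cone $K$. 2. If, in addition, $X$ contains arbitrarily long geodesic segments, then $K_3(X)=K$.
   Context: $\mathbb{R}_+=[0,\infty)$. For a metric space $(X,d)$, $K_3(X)$ is the set of all $(a,b,c)\in\mathbb{R}_+^3$ for which there exist points $x,y,z\in X$ with $d(x,y)=a$, $d(y,z)=b$, $d(z,x)=c$. The cone $K:=K_3(\mathbb{R}^2)$ is $\{(a,b,c)\in\mathbb{R}_+^3: a\le b+c,\ b\le a+c,\ c\le a+b\}$; its interior is taken in $\mathbb{R}^3$. A path metric space is a metric space $X$ such that for all $x,y\in X$, $d(x,y)$ equals the infimum of the lengths of continuous paths in $X$ connecting $x$ to $y$. A geodesic segment in $X$ is (the image of) an isometric embedding of a compact interval into $X$. A map $f:X\to Y$ of metric spaces is an $(L,A)$-quasi-isometry ($L\ge 1$, $A\in\mathbb{R}$) if $L^{-1}d(x_1,x_2)-A\le d(f(x_1),f(x_2))\le L\,d(x_1,x_2)+A$ for all $x_1,x_2\in X$ and every point of $Y$ is at distance $\le A$ from $f(X)$. $X$ and $Y$ are quasi-isometric if there is an $(L,A)$-quasi-isometry $X\to Y$ for some $L,A$. *)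

theory Defs
  imports "HOL-Analysis.Analysis"
begin

text \<open>A metric space \<open>X\<close> is modelled as a subset of a type of class \<open>metric_space\<close> carrying
  the restricted distance; \<open>UNIV\<close> is allowed.  All notions below are intrinsic to \<open>X\<close>.\<close>

definition K3 :: "'a::metric_space set \<Rightarrow> (real \<times> real \<times> real) set" where
  "K3 X = {(a, b, c). \<exists>x\<in>X. \<exists>y\<in>X. \<exists>z\<in>X. dist x y = a \<and> dist y z = b \<and> dist z x = c}"

definition triangle_cone :: "(real \<times> real \<times> real) set" where
  "triangle_cone = K3 (UNIV :: (real ^ 2) set)"

text \<open>Length of a path parametrised by \<open>{0..1}\<close>: supremum over all partitions
  \<open>0 = t 0 \<le> \<dots> \<le> t n = 1\<close>, with value infinity for non-rectifiable paths.\<close>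

definition path_length :: "(real \<Rightarrow> 'a::metric_space) \<Rightarrow> ennreal" where
  "path_length g =
    (SUP (n, t) \<in> {(n :: nat, t :: nat \<Rightarrow> real). t 0 = 0 \<and> t n = 1 \<and> (\<forall>i<n. t i \<le> t (Suc i))}.
      ennreal (\<Sum>i<n. dist (g (t i)) (g (t (Suc i)))))"

text \<open>The infimum is taken in \<open>ennreal\<close>, so that it is infinite if no path in \<open>X\<close> joins the points.\<close>

definition path_metric_space :: "'a::metric_space set \<Rightarrow> bool" where
  "path_metric_space X \<longleftrightarrow>
    (\<forall>x\<in>X. \<forall>y\<in>X. ennreal (dist x y) =
      (INF g \<in> {g. path g \<and> path_image g \<subseteq> X \<and> pathstart g = x \<and> pathfinish g = y}.
        path_length g))"

definition isometric_embedding ::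
    "('a::metric_space \<Rightarrow> 'b::metric_space) \<Rightarrow> 'a set \<Rightarrow> 'b set \<Rightarrow> bool" where
  "isometric_embedding f X Y \<longleftrightarrow>
    f ` X \<subseteq> Y \<and> (\<forall>x\<in>X. \<forall>y\<in>X. dist (f x) (f y) = dist x y)"

definition geodesic_segment :: "'a::metric_space set \<Rightarrow> real \<Rightarrow> 'a set \<Rightarrow> bool" where
  \<comment> \<open>\<open>S\<close> is a geodesic segment of length \<open>l\<close> in \<open>X\<close>\<close>
  "geodesic_segment X l S \<longleftrightarrow>
    (\<exists>a b :: real. \<exists>f. a \<le> b \<and> l = b - a \<and>
      isometric_embedding f {a..b} X \<and> S = f ` {a..b})"

definition has_arbitrarily_long_geodesics :: "'a::metric_space set \<Rightarrow> bool" where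
  "has_arbitrarily_long_geodesics X \<longleftrightarrow> (\<forall>R :: real. \<exists>l\<ge>R. \<exists>S. geodesic_segment X l S)"

text \<open>The condition \<open>f ` X \<noteq> {}\<close> is needed since \<open>infdist y {} = 0\<close> by convention.\<close>

definition quasi_isometry ::
    "real \<Rightarrow> real \<Rightarrow> 'a::metric_space set \<Rightarrow> 'b::metric_space set \<Rightarrow> ('a \<Rightarrow> 'b) \<Rightarrow> bool" where
  "quasi_isometry L A X Y f \<longleftrightarrow>
    L \<ge> 1 \<and> f ` X \<subseteq> Y \<and>
    (\<forall>x\<^sub>1\<in>X. \<forall>x\<^sub>2\<in>X.
      inverse L * dist x\<^sub>1 x\<^sub>2 - A \<le> dist (f x\<^sub>1) (f x\<^sub>2) \<and>
      dist (f x\<^sub>1) (f x\<^sub>2) \<le> L * dist x\<^sub>1 x\<^sub>2 + A) \<and>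
    (\<forall>y\<in>Y. f ` X \<noteq> {} \<and> infdist y (f ` X) \<le> A)"

definition quasi_isometric :: "'a::metric_space set \<Rightarrow> 'b::metric_space set \<Rightarrow> bool" where
  "quasi_isometric X Y \<longleftrightarrow> (\<exists>L A f. quasi_isometry L A X Y f)"

lemma triangle_cone_eq:
  "triangle_cone = {(a, b, c). 0 \<le> a \<and> 0 \<le> b \<and> 0 \<le> c \<and> a \<le> b + c \<and> b \<le> a + c \<and> c \<le> a + b}"
proof -
  have ex: "\<exists>x y z :: real ^ 2. dist x y = a \<and> dist y z = b \<and> dist z x = c"
    if h: "0 \<le> a" "0 \<le> b" "0 \<le> c" "a \<le> b + c" "b \<le> a + c" "c \<le> a + b" for a b c
  proof -
    have "\<exists>u v. u\<^sup>2 + v\<^sup>2 = c\<^sup>2 \<and> (a - u)\<^sup>2 + v\<^sup>2 = b\<^sup>2"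
    proof (cases "a = 0")
      case True
      then show ?thesis using h by (intro exI[of _ c] exI[of _ 0]) auto
    next
      case False
      define u where "u = (a\<^sup>2 + c\<^sup>2 - b\<^sup>2) / (2 * a)"
      have au: "2 * a * u = a\<^sup>2 + c\<^sup>2 - b\<^sup>2" using False by (simp add: u_def)
      have "(a - c)\<^sup>2 \<le> b\<^sup>2" "b\<^sup>2 \<le> (a + c)\<^sup>2"
        using h by (auto simp: abs_le_square_iff[symmetric])
      then have "2 * a * u \<le> 2 * a * c" "2 * a * (- u) \<le> 2 * a * c"
        using au by (auto simp: power2_eq_square algebra_simps)
      moreover have "2 * a > 0" using h(1) False by simp
      ultimately have "u \<le> c" "- u \<le> c"
        by (simp_all only: mult_le_cancel_left_pos)
      then have "\<bar>u\<bar> \<le> \<bar>c\<bar>" by linarith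
      then have "u\<^sup>2 \<le> c\<^sup>2" by (simp add: abs_le_square_iff)
      then show ?thesis using au
        by (intro exI[of _ u] exI[of _ "sqrt (c\<^sup>2 - u\<^sup>2)"])
          (auto simp: power2_eq_square algebra_simps)
    qed
    then obtain u v where uv: "u\<^sup>2 + v\<^sup>2 = c\<^sup>2" "(a - u)\<^sup>2 + v\<^sup>2 = b\<^sup>2" by blast
    show ?thesis
      by (rule exI[of _ "vector [0, 0]"], rule exI[of _ "vector [a, 0]"],
          rule exI[of _ "vector [u, v]"])
        (use h uv in \<open>simp add: dist_vec_def L2_set_def UNIV_2 dist_real_def\<close>)
  qed
  have tri: "a \<le> b + c \<and> b \<le> a + c \<and> c \<le> a + b"
    if "dist x y = a" "dist y z = b" "dist z x = c" for x y z :: "real ^ 2" and a b c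
    using that dist_triangle[of x y z] dist_triangle[of y z x] dist_triangle[of z x y]
    by (auto simp: dist_commute)
  have "(a, b, c) \<in> triangle_cone \<longleftrightarrow>
      0 \<le> a \<and> 0 \<le> b \<and> 0 \<le> c \<and> a \<le> b + c \<and> b \<le> a + c \<and> c \<le> a + b" (is "_ \<longleftrightarrow> ?R") for a b c
  proof
    assume "(a, b, c) \<in> triangle_cone"
    then obtain x y z :: "real ^ 2" where "dist x y = a" "dist y z = b" "dist z x = c"
      by (auto simp: triangle_cone_def K3_def)
    then show ?R using tri zero_le_dist by blast
  next
    assume ?R
    then obtain x y z :: "real ^ 2" where "dist x y = a" "dist y z = b" "dist z x = c"
      using ex[of a b c] by blast
    then show "(a, b, c) \<in> triangle_cone" by (auto simp: triangle_cone_def K3_def)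
  qed
  then show ?thesis by auto
qed

end

theory Submission
  imports Defs
begin

text \<open>A tripod is a near-geodesic \<open>g\<close> together with a path \<open>h\<close> that starts on \<open>g\<close>, avoids large
  balls around the ends of \<open>g\<close> and ends far from \<open>g\<close>.  Moving two vertices of a triangle along \<open>g\<close>
  and the third along \<open>h\<close>, Brouwer's theorem on the cube of parameters yields every triple of side
  lengths that satisfies the strict triangle inequalities with room to spare for the error of the
  near-geodesic.

  If there are no large tripods, a point far from a near-geodesic sees all of it through one of its
  ends, up to a bounded error.  Fix a base point \<open>p\<close>.  Either every ball around \<open>p\<close> lies
  uniformly close to a near-geodesic issuing from \<open>p\<close>, and the distance to \<open>p\<close> is a
  quasi-isometry onto the ray; or there are arbitrarily long near-geodesics passing close to \<open>p\<close>
  with both ends far from it, every ball around \<open>p\<close> lies close to one of them, and a signed distance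
  to \<open>p\<close> is a quasi-isometry to the line.\<close>

section \<open>Near-geodesics\<close>

text \<open>Additivity up to \<open>e\<close> on ordered triples is a length-free substitute for
  being almost shortest. Every path whose length exceeds the distance of its ends by less than
  \<open>e\<close> has it.\<close>

definition near_geodesic :: "real \<Rightarrow> 'a::metric_space set \<Rightarrow> (real \<Rightarrow> 'a) \<Rightarrow> bool" where
  "near_geodesic e X g \<longleftrightarrow> path g \<and> path_image g \<subseteq> X \<and>
    (\<forall>s t u. 0 \<le> s \<and> s \<le> t \<and> t \<le> u \<and> u \<le> 1 \<longrightarrow>
      dist (g s) (g t) + dist (g t) (g u) \<le> dist (g s) (g u) + e)"

lemma near_geodesicD:
  assumes "near_geodesic e X g"
  shows "path g" "path_image g \<subseteq> X" "continuous_on {0..1} g"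
    "\<And>t. 0 \<le> t \<Longrightarrow> t \<le> 1 \<Longrightarrow> g t \<in> X"
    "\<And>s t u. 0 \<le> s \<Longrightarrow> s \<le> t \<Longrightarrow> t \<le> u \<Longrightarrow> u \<le> 1 \<Longrightarrow>
      dist (g s) (g t) + dist (g t) (g u) \<le> dist (g s) (g u) + e"
proof -
  show g: "path g" "path_image g \<subseteq> X"
    and "\<And>s t u. 0 \<le> s \<Longrightarrow> s \<le> t \<Longrightarrow> t \<le> u \<Longrightarrow> u \<le> 1 \<Longrightarrow>
      dist (g s) (g t) + dist (g t) (g u) \<le> dist (g s) (g u) + e"
    using assms unfolding near_geodesic_def by blast+
  show "continuous_on {0..1} g"
    using g(1) unfolding path_def .
  show "g t \<in> X" if "0 \<le> t" "t \<le> 1" for t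
    by (rule subsetD[OF g(2)]) (simp add: path_image_def that)
qed

text \<open>The infimum of lengths provides a path with excess less than \<open>e\<close>. Its
  length dominates the sum over the partition \<open>0, s, t, u, 1\<close>, so the excess of the
  stretch from \<open>s\<close> through \<open>t\<close> to \<open>u\<close> is bounded by that of
  the whole path.\<close>

lemma near_geodesic_exists:
  assumes X: "path_metric_space X" and "x \<in> X" "y \<in> X" "e > 0"
  obtains g where "near_geodesic e X g" "g 0 = x" "g 1 = y"
proof -
  let ?P = "{g. path g \<and> path_image g \<subseteq> X \<and> pathstart g = x \<and> pathfinish g = y}"
  have "(INF g \<in> ?P. path_length g) = ennreal (dist x y)"
    using X[unfolded path_metric_space_def, rule_format, OF assms(2,3)] by (rule sym)
  also have "\<dots> < ennreal (dist x y + e)"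
    using \<open>e > 0\<close> by (simp add: ennreal_less_iff)
  finally obtain g where g: "g \<in> ?P" and len: "path_length g < ennreal (dist x y + e)"
    by (auto simp: Inf_less_iff)
  have ends: "g 0 = x" "g 1 = y"
    using g by (auto simp: pathstart_def pathfinish_def)
  have "dist (g s) (g t) + dist (g t) (g u) \<le> dist (g s) (g u) + e"
    if "0 \<le> s" "s \<le> t" "t \<le> u" "u \<le> 1" for s t u
  proof -
    define T where "T = (\<lambda>i::nat. [0, s, t, u, 1] ! i)"
    have T: "T 0 = 0" "T 1 = s" "T 2 = t" "T 3 = u" "T 4 = 1"
      by (simp_all add: T_def)
    have "\<forall>i<4. T i \<le> T (Suc i)"
      using that by (auto simp: T_def less_Suc_eq numeral_eq_Suc)
    then have "ennreal (\<Sum>i<4. dist (g (T i)) (g (T (Suc i)))) \<le> path_length g"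
      unfolding path_length_def using T
      by (intro SUP_upper2[where i = "(4, T)"]) auto
    also have "(\<Sum>i<4. dist (g (T i)) (g (T (Suc i)))) =
        dist x (g s) + dist (g s) (g t) + dist (g t) (g u) + dist (g u) y"
      using T ends by (simp add: eval_nat_numeral)
    finally have "ennreal (dist x (g s) + dist (g s) (g t) + dist (g t) (g u) + dist (g u) y)
        < ennreal (dist x y + e)"
      using len by simp
    then have "dist x (g s) + dist (g s) (g t) + dist (g t) (g u) + dist (g u) y < dist x y + e"
      by (subst (asm) ennreal_less_iff) auto
    moreover have "dist x y \<le> dist x (g s) + dist (g s) (g u) + dist (g u) y"
      by metric
    ultimately show ?thesis by linarith
  qed
  then have "near_geodesic e X g"
    using g by (auto simp: near_geodesic_def)
  then show thesis using that ends by blast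
qed

section \<open>Strict triangles realized on a tripod\<close>

lemma strict_triangle_if_interior:
  assumes "(a, b, c) \<in> interior triangle_cone"
  shows "a < b + c" "b < a + c" "c < a + b"
proof -
  obtain r where r: "r > 0" "ball (a, b, c) r \<subseteq> triangle_cone"
    using assms by (auto simp: mem_interior)
  have "(a + r / 2, b, c) \<in> ball (a, b, c) r" "(a, b + r / 2, c) \<in> ball (a, b, c) r"
    "(a, b, c + r / 2) \<in> ball (a, b, c) r"
    using r(1) by (auto simp: dist_prod_def dist_real_def)
  then have "(a + r / 2, b, c) \<in> triangle_cone" "(a, b + r / 2, c) \<in> triangle_cone"
    "(a, b, c + r / 2) \<in> triangle_cone"
    using r(2) by blast+
  then show "a < b + c" "b < a + c" "c < a + b"
    using r(1) by (auto simp: triangle_cone_eq)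
qed

text \<open>The conclusion says that the field lies in the outer normal cone of the cube at the point found.
  It follows from Brouwer's theorem for the displacement by the field followed by the nearest-point
  projection.\<close>

lemma cube_vector_field:
  fixes v1 v2 v3 :: "real \<times> real \<times> real \<Rightarrow> real"
  defines "Q \<equiv> {0..1} \<times> {0..1} \<times> {0..1}"
  assumes "continuous_on Q v1" "continuous_on Q v2" "continuous_on Q v3"
  obtains x y z where "x \<in> {0..1}" "y \<in> {0..1}" "z \<in> {0..1}"
    "v1 (x, y, z) < 0 \<Longrightarrow> x = 0" "v1 (x, y, z) > 0 \<Longrightarrow> x = 1"
    "v2 (x, y, z) < 0 \<Longrightarrow> y = 0" "v2 (x, y, z) > 0 \<Longrightarrow> y = 1"
    "v3 (x, y, z) < 0 \<Longrightarrow> z = 0" "v3 (x, y, z) > 0 \<Longrightarrow> z = 1"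
proof -
  define cl :: "real \<Rightarrow> real" where "cl = (\<lambda>x. max 0 (min 1 x))"
  define F where "F = (\<lambda>w. (cl (fst w + v1 w), cl (fst (snd w) + v2 w), cl (snd (snd w) + v3 w)))"
  have "compact Q" "convex Q" "Q \<noteq> {}"
    unfolding Q_def by (auto intro!: compact_Times convex_Times)
  moreover have "continuous_on Q F"
    unfolding F_def cl_def using assms(2-4) by (intro continuous_intros)
  moreover have "F \<in> Q \<rightarrow> Q"
    by (auto simp: F_def cl_def Q_def)
  ultimately obtain w where "w \<in> Q" "F w = w"
    using brouwer[of Q F] by blast
  moreover obtain x y z where w: "w = (x, y, z)"
    by (metis prod.exhaust)
  ultimately have "x \<in> {0..1}" "y \<in> {0..1}" "z \<in> {0..1}"
    "cl (x + v1 (x, y, z)) = x" "cl (y + v2 (x, y, z)) = y" "cl (z + v3 (x, y, z)) = z"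
    by (auto simp: Q_def F_def)
  then show thesis
    by (intro that[of x y z]) (auto simp: cl_def max_def min_def split: if_splits)
qed

lemma tripod_realizes:
  assumes g: "near_geodesic e X g" and \<tau>: "\<tau> \<in> {0..1}"
    and h: "path h" "path_image h \<subseteq> X" "h 0 = g \<tau>"
    and far: "\<And>t. t \<in> {0..1} \<Longrightarrow> dist (h 1) (g t) > b + c"
    and ends: "\<And>t. t \<in> {0..1} \<Longrightarrow> dist (h t) (g 0) > b + c"
      "\<And>t. t \<in> {0..1} \<Longrightarrow> dist (h t) (g 1) > b + c"
    and abc: "a > 0" "a + e < b + c" "b + e < a + c" "c + e < a + b"
  shows "(a, b, c) \<in> K3 X"
proof -
  \<comment> \<open>Clamping keeps both ends of the base on \<open>g\<close> even where
    \<open>u - r\<close> or \<open>u + r\<close> leaves the unit interval; for \<open>r = 1\<close>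
    they are the two ends of \<open>g\<close>, whatever \<open>u\<close> is.\<close>
  define cl :: "real \<Rightarrow> real" where "cl = (\<lambda>x. max 0 (min 1 x))"
  \<comment> \<open>The parameters are the midpoint and the half-width of the base on \<open>g\<close> and the position on \<open>h\<close>.
    They are driven by the errors in \<open>b - c\<close>, \<open>a\<close> and \<open>b + c\<close>; this field is
    never an outer normal at the boundary of the cube, so all three errors vanish somewhere.\<close>
  define p where "p = (\<lambda>w::real \<times> real \<times> real. g (cl (fst w - fst (snd w))))"
  define q where "q = (\<lambda>w::real \<times> real \<times> real. g (cl (fst w + fst (snd w))))"
  define z where "z = (\<lambda>w::real \<times> real \<times> real. h (snd (snd w)))"
  have cl: "cl x \<in> {0..1}" for x
    by (auto simp: cl_def)
  let ?Q = "{0..1} \<times> {0..1} \<times> {0..1::real}"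
  have cont: "continuous_on ?Q p" "continuous_on ?Q q" "continuous_on ?Q z"
    unfolding p_def q_def z_def
    by (rule continuous_on_compose2[OF near_geodesicD(3)[OF g]]
          continuous_on_compose2[OF h(1)[unfolded path_def]];
        force simp: cl_def intro!: continuous_intros)+
  obtain u r t where in01: "u \<in> {0..1}" "r \<in> {0..1}" "t \<in> {0..1}"
    and V: "b - c - dist (q (u, r, t)) (z (u, r, t)) + dist (z (u, r, t)) (p (u, r, t)) < 0 \<Longrightarrow> u = 0"
      "b - c - dist (q (u, r, t)) (z (u, r, t)) + dist (z (u, r, t)) (p (u, r, t)) > 0 \<Longrightarrow> u = 1"
      "a - dist (p (u, r, t)) (q (u, r, t)) < 0 \<Longrightarrow> r = 0"
      "a - dist (p (u, r, t)) (q (u, r, t)) > 0 \<Longrightarrow> r = 1"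
      "b + c - dist (q (u, r, t)) (z (u, r, t)) - dist (z (u, r, t)) (p (u, r, t)) < 0 \<Longrightarrow> t = 0"
      "b + c - dist (q (u, r, t)) (z (u, r, t)) - dist (z (u, r, t)) (p (u, r, t)) > 0 \<Longrightarrow> t = 1"
    by (rule cube_vector_field[of
          "\<lambda>w. b - c - dist (q w) (z w) + dist (z w) (p w)"
          "\<lambda>w. a - dist (p w) (q w)"
          "\<lambda>w. b + c - dist (q w) (z w) - dist (z w) (p w)"])
      (use cont in \<open>auto intro!: continuous_intros\<close>)
  define P where "P = g (cl (u - r))"
  define R where "R = g (cl (u + r))"
  define Z where "Z = h t"
  have pqz: "p (u, r, t) = P" "q (u, r, t) = R" "z (u, r, t) = Z"
    by (simp_all add: p_def q_def z_def P_def R_def Z_def)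
  note V = V[unfolded pqz]
  have inX: "P \<in> X" "R \<in> X" "Z \<in> X"
    using near_geodesicD(4)[OF g] cl in01(3) h(2) by (auto simp: P_def R_def Z_def path_image_def)
  note geo = near_geodesicD(5)[OF g]
  have "e \<ge> 0" using geo[of 0 0 0] by simp
  then have pos: "b + c > 0" using abc by linarith
  \<comment> \<open>This rules out a too short base at \<open>r = 1\<close>: the foot
    \<open>g \<tau>\<close> is far from both ends, so the ends are almost \<open>2 * (b + c)\<close>
    apart.\<close>
  have long: "dist (g 0) (g 1) \<ge> a"
  proof -
    have "dist (g 0) (g \<tau>) + dist (g \<tau>) (g 1) \<le> dist (g 0) (g 1) + e"
      using geo[of 0 \<tau> 1] \<tau> by simp
    moreover have "dist (g 0) (g \<tau>) > b + c" "dist (g \<tau>) (g 1) > b + c"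
      using ends[of 0] h(3) by (simp_all add: dist_commute)
    ultimately show ?thesis using abc \<open>e \<ge> 0\<close> by linarith
  qed
  have side1: "dist P R = a"
  proof (rule antisym; rule ccontr)
    assume "\<not> dist P R \<le> a"
    then have "r = 0" using V(3) by simp
    with \<open>\<not> dist P R \<le> a\<close> abc show False by (simp add: P_def R_def)
  next
    assume n: "\<not> a \<le> dist P R"
    then have "r = 1" using V(4) by simp
    then have "P = g 0" "R = g 1" using in01 by (simp_all add: P_def R_def cl_def)
    with n long show False by simp
  qed
  have side2: "dist R Z + dist Z P = b + c"
  proof (rule antisym; rule ccontr)
    assume n: "\<not> b + c \<le> dist R Z + dist Z P"
    then have "t = 1" using V(6) by simp
    then have "dist Z P > b + c" using far cl by (simp add: Z_def P_def)
    with n show False using zero_le_dist[of R Z] by linarith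
  next
    assume n: "\<not> dist R Z + dist Z P \<le> b + c"
    then have "t = 0" using V(5) by simp
    then have Z: "Z = g \<tau>" by (simp add: Z_def h)
    have mono: "cl (u - r) \<le> cl (u + r)" using in01 by (auto simp: cl_def)
    have off: "dist (g \<tau>) (g 0) > b + c" "dist (g \<tau>) (g 1) > b + c"
      using ends[of 0] h(3) by simp_all
    \<comment> \<open>With the foot between \<open>P\<close> and \<open>R\<close>, the sum is at
      most \<open>a + e < b + c\<close>. With the foot outside, the difference of the two distances
      is at least \<open>a - e\<close> in absolute value, so the first field component drives the
      base to the end of \<open>g\<close> on the side of the foot. This makes the foot an end of
      \<open>g\<close>, contradicting \<open>ends\<close>.\<close>
    consider "\<tau> \<le> cl (u - r)" | "cl (u - r) \<le> \<tau>" "\<tau> \<le> cl (u + r)" | "cl (u + r) \<le> \<tau>"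
      by linarith
    then show False
    proof cases
      case 1
      then have "dist Z P + dist P R \<le> dist Z R + e"
        unfolding Z P_def R_def using mono cl[of "u + r"] \<tau> by (intro geo) auto
      then have "u = 0" using V(1) side1 abc by (simp add: dist_commute)
      then have "\<tau> = 0" using 1 \<tau> in01 by (simp add: cl_def)
      then show False using off pos by simp
    next
      case 2
      then have "dist P Z + dist Z R \<le> dist P R + e"
        unfolding Z P_def R_def using cl by (intro geo) auto
      then show False using n side1 abc by (simp add: dist_commute)
    next
      case 3
      then have "dist P R + dist R Z \<le> dist P Z + e"
        unfolding Z P_def R_def using mono cl[of "u - r"] \<tau> by (intro geo) auto
      then have "u = 1" using V(2) side1 abc by (simp add: dist_commute)
      then have "\<tau> = 1" using 3 \<tau> in01 by (simp add: cl_def)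
      then show False using off pos by simp
    qed
  qed
  \<comment> \<open>At an extreme \<open>u\<close> one vertex is an end of \<open>g\<close>; its
    distance to \<open>h\<close> alone exceeds the sum \<open>b + c\<close> already
    established.\<close>
  have side3: "dist R Z - dist Z P = b - c"
  proof (rule antisym; rule ccontr)
    assume "\<not> dist R Z - dist Z P \<le> b - c"
    then have "u = 0" using V(1) by simp
    then have "P = g 0" using in01 by (simp add: P_def cl_def)
    then have "dist Z P > b + c" using ends(1)[OF in01(3)] by (simp add: Z_def)
    then show False using side2 zero_le_dist[of R Z] by linarith
  next
    assume "\<not> b - c \<le> dist R Z - dist Z P"
    then have "u = 1" using V(2) by simp
    then have "R = g 1" using in01 by (simp add: R_def cl_def)
    then have "dist R Z > b + c" using ends(2)[OF in01(3)] by (simp add: Z_def dist_commute)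
    then show False using side2 zero_le_dist[of Z P] by linarith
  qed
  have "dist R Z = b" "dist Z P = c" using side2 side3 by linarith+
  then show ?thesis using inX side1 by (auto simp: K3_def)
qed

section \<open>Consequences of the absence of large tripods\<close>

definition no_tripods :: "real \<Rightarrow> real \<Rightarrow> 'a::metric_space set \<Rightarrow> bool" where
  "no_tripods e D X \<longleftrightarrow> (\<forall>g h \<tau>. near_geodesic e X g \<and> \<tau> \<in> {0..1} \<and>
    path h \<and> path_image h \<subseteq> X \<and> h 0 = g \<tau> \<and> (\<forall>t\<in>{0..1}. dist (h 1) (g t) > D) \<longrightarrow>
    (\<exists>t\<in>{0..1}. dist (h t) (g 0) \<le> D \<or> dist (h t) (g 1) \<le> D))"

lemma no_tripods_if_not_realized:
  assumes "(a, b, c) \<notin> K3 X" "a > 0" "a + e < b + c" "b + e < a + c" "c + e < a + b"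
  shows "no_tripods e (b + c) X"
  unfolding no_tripods_def
proof (intro allI impI, elim conjE)
  fix g h \<tau>
  assume *: "near_geodesic e X g" "\<tau> \<in> {0..1}" "path h" "path_image h \<subseteq> X" "h 0 = g \<tau>"
    "\<forall>t\<in>{0..1}. dist (h 1) (g t) > b + c"
  show "\<exists>t\<in>{0..1}. dist (h t) (g 0) \<le> b + c \<or> dist (h t) (g 1) \<le> b + c"
  proof (rule ccontr)
    assume "\<not> ?thesis"
    then have "(a, b, c) \<in> K3 X"
      using * assms(2-) by (intro tripod_realizes[of e X g \<tau> h]) (auto simp: not_le)
    with assms(1) show False by blast
  qed
qed

text \<open>A near-geodesic from \<open>g t\<close> to \<open>q\<close> would complete a tripod
  unless it comes within \<open>D\<close> of an end of \<open>g\<close>. A detour through that end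
  then costs at most \<open>2 * D\<close>, on top of the defect \<open>e\<close>.\<close>

lemma far_point_behind_ends:
  assumes X: "path_metric_space X" and NT: "no_tripods e D X" and e: "e > 0"
    and g: "near_geodesic e X g" and q: "q \<in> X" and far: "\<And>t. t \<in> {0..1} \<Longrightarrow> dist q (g t) > D"
    and t: "t \<in> {0..1}"
  shows "dist q (g 0) + dist (g 0) (g t) \<le> dist q (g t) + 2 * D + e \<or>
    dist q (g 1) + dist (g 1) (g t) \<le> dist q (g t) + 2 * D + e"
proof -
  have "g t \<in> X" using near_geodesicD(4)[OF g] t by auto
  then obtain h where h: "near_geodesic e X h" "h 0 = g t" "h 1 = q"
    using near_geodesic_exists[OF X _ q e] by blast
  have "\<exists>s\<in>{0..1}. dist (h s) (g 0) \<le> D \<or> dist (h s) (g 1) \<le> D"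
    using NT h near_geodesicD(1,2)[OF h(1)] g t far unfolding no_tripods_def by blast
  then obtain s where s: "s \<in> {0..1}" "dist (h s) (g 0) \<le> D \<or> dist (h s) (g 1) \<le> D" by blast
  have "dist (h 0) (h s) + dist (h s) (h 1) \<le> dist (h 0) (h 1) + e"
    using near_geodesicD(5)[OF h(1), of 0 s 1] s by simp
  then have "dist (g t) (h s) + dist (h s) q \<le> dist (g t) q + e" by (simp add: h)
  moreover have "dist q y + dist y (g t) \<le> dist (g t) (h s) + dist (h s) q + 2 * dist (h s) y" for y
    by metric
  ultimately show ?thesis using s(2) by (smt (verit) dist_commute)
qed

section \<open>Coordinates from distances: the ray and the line\<close>

lemma dist_attains:
  fixes g :: "real \<Rightarrow> 'a::metric_space"
  assumes g: "continuous_on {s..t} g" and "s \<le> t"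
    and "dist p (g s) \<le> y \<and> y \<le> dist p (g t) \<or> dist p (g t) \<le> y \<and> y \<le> dist p (g s)"
  obtains u where "s \<le> u" "u \<le> t" "dist p (g u) = y"
proof -
  have "continuous_on {s..t} (\<lambda>u. dist p (g u))" using g by (intro continuous_intros)
  then show thesis using assms(2,3) that IVT'[of "\<lambda>u. dist p (g u)" s y t]
      IVT2'[of "\<lambda>u. dist p (g u)" t y s] by blast
qed

lemma unbounded_dist_attains:
  assumes "path_metric_space X" "\<not> bounded X" "p \<in> X" "y \<ge> 0"
  obtains x where "x \<in> X" "dist p x = y"
proof -
  obtain z where z: "z \<in> X" "dist p z \<ge> y"
    using assms(2) unfolding bounded_any_center[of X p] by (meson linear)
  obtain g where g: "near_geodesic 1 X g" "g 0 = p" "g 1 = z"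
    using near_geodesic_exists[OF assms(1,3) z(1), of 1] by auto
  obtain u where "0 \<le> u" "u \<le> 1" "dist p (g u) = y"
    using dist_attains[OF near_geodesicD(3)[OF g(1)], of p y] z g assms(4) by auto
  then show thesis using that near_geodesicD(4)[OF g(1)] by blast
qed

text \<open>Along \<open>g\<close> the distance from \<open>g 0\<close> is additive up to
  \<open>e\<close>. Passing from \<open>u\<close> and \<open>v\<close> to points of \<open>g\<close>
  costs \<open>2 * C\<close> in \<open>dist u v\<close> and another \<open>2 * C\<close> in the two
  distances from \<open>g 0\<close>.\<close>

lemma near_geodesic_dist_le:
  assumes g: "near_geodesic e X g" and "s \<in> {0..1}" "t \<in> {0..1}"
    and "dist u (g s) \<le> C" "dist v (g t) \<le> C"
  shows "dist u v \<le> \<bar>dist (g 0) u - dist (g 0) v\<bar> + 4 * C + e"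
proof -
  have *: "dist x y \<le> dist (g 0) y - dist (g 0) x + 4 * C + e"
    if "0 \<le> s" "s \<le> t" "t \<le> 1" "dist x (g s) \<le> C" "dist y (g t) \<le> C" for x y s t
  proof -
    have "dist (g 0) (g s) + dist (g s) (g t) \<le> dist (g 0) (g t) + e"
      using near_geodesicD(5)[OF g] that by auto
    moreover have "dist x y \<le> dist x (g s) + dist (g s) (g t) + dist y (g t)"
      "dist (g 0) x \<le> dist (g 0) (g s) + dist x (g s)"
      "dist (g 0) (g t) \<le> dist (g 0) y + dist y (g t)"
      by metric+
    ultimately show ?thesis using that by linarith
  qed
  show ?thesis
    using *[of s t u v] *[of t s v u] assms(2-) by (cases "s \<le> t") (auto simp: dist_commute)
qed

text \<open>The near-geodesic may change with \<open>r\<close>, but \<open>C\<close> may not: each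
  pair \<open>u\<close>, \<open>v\<close> is compared along a near-geodesic that serves a ball
  containing both, with an error independent of the pair.\<close>

lemma quasi_isometric_ray:
  assumes X: "path_metric_space X" "\<not> bounded X" "p \<in> X"
    and C: "\<And>r. \<exists>g. near_geodesic e X g \<and> g 0 = p \<and>
      (\<forall>q\<in>X. dist p q \<le> r \<longrightarrow> (\<exists>t\<in>{0..1}. dist q (g t) \<le> C))"
  shows "quasi_isometric X ({0..} :: real set)"
proof -
  have lower: "dist u v \<le> \<bar>dist p u - dist p v\<bar> + (4 * C + e)" if uv: "u \<in> X" "v \<in> X" for u v
  proof -
    obtain g where g: "near_geodesic e X g" "g 0 = p"
      and n: "\<And>q. q \<in> X \<Longrightarrow> dist p q \<le> max (dist p u) (dist p v) \<Longrightarrow> \<exists>t\<in>{0..1}. dist q (g t) \<le> C"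
      using C by meson
    obtain s t where "s \<in> {0..1}" "t \<in> {0..1}" "dist u (g s) \<le> C" "dist v (g t) \<le> C"
      using n[OF uv(1)] n[OF uv(2)] by auto
    from near_geodesic_dist_le[OF g(1) this] show ?thesis by (simp add: g)
  qed
  have A: "4 * C + e \<ge> 0" using lower[OF X(3) X(3)] by simp
  have onto: "dist p ` X = {0..}"
  proof (intro equalityI subsetI)
    fix y :: real assume "y \<in> {0..}"
    then obtain x where "x \<in> X" "dist p x = y"
      using unbounded_dist_attains[OF X, of y] by auto
    then show "y \<in> dist p ` X" by blast
  qed auto
  have upper: "\<bar>dist p u - dist p v\<bar> \<le> dist u v" for u v by metric
  have "quasi_isometry 1 (4 * C + e) X ({0..} :: real set) (dist p)"
    unfolding quasi_isometry_def onto
  proof (intro conjI ballI)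
    fix u v assume "u \<in> X" "v \<in> X"
    then show "inverse 1 * dist u v - (4 * C + e) \<le> dist (dist p u) (dist p v)"
      and "dist (dist p u) (dist p v) \<le> 1 * dist u v + (4 * C + e)"
      using A lower[of u v] upper[of u v] by (simp_all add: dist_real_def)
  qed (use A in auto)
  then show ?thesis unfolding quasi_isometric_def by blast
qed

text \<open>The sign of the coordinate of \<open>u\<close> is read off from its distance to a reference point \<open>x\<close>
  far from \<open>p\<close>; it may come out wrong only for \<open>u\<close> within bounded distance of \<open>p\<close>.\<close>

lemma signed_dist_coordinate:
  fixes c :: "'a::metric_space \<Rightarrow> real"
  assumes c: "\<And>u v. u \<in> B \<Longrightarrow> v \<in> B \<Longrightarrow> \<bar>dist u v - \<bar>c u - c v\<bar>\<bar> \<le> K"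
    and B: "p \<in> B" "x \<in> B" "u \<in> B" "v \<in> B" and x: "dist p x > 3 * K"
  defines "f \<equiv> \<lambda>u. if dist u x < dist u p then dist u p else - dist u p"
  shows "\<bar>dist u v - \<bar>f u - f v\<bar>\<bar> \<le> 4 * dist p x + 7 * K"
proof -
  \<comment> \<open>\<open>k\<close> is \<open>c\<close> recentred at \<open>p\<close> and reflected
    so that \<open>x\<close> has a nonnegative coordinate.\<close>
  define k where "k = (\<lambda>u. if c x \<ge> c p then c u - c p else c p - c u)"
  have k: "\<bar>dist u v - \<bar>k u - k v\<bar>\<bar> \<le> K" if "u \<in> B" "v \<in> B" for u v
    using c[OF that] by (auto simp: k_def abs_minus_commute)
  have k0: "k p = 0" "k x \<ge> 0" by (auto simp: k_def)
  have K: "K \<ge> 0" using c[OF B(1) B(1)] by simp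
  \<comment> \<open>Since \<open>dist p x > 3 * K\<close> gives \<open>k x > 2 * K\<close>, a point
    with \<open>k u < 0\<close> is never nearer to \<open>x\<close> than to \<open>p\<close>. A
    point with \<open>k u > 0\<close> gets the wrong sign only if \<open>k u < k x\<close>, hence
    near \<open>p\<close>. Where the signs agree the error is at most \<open>K\<close>.\<close>
  have "\<bar>f u - k u\<bar> \<le> 2 * dist p x + 3 * K" if u: "u \<in> B" for u
    using k[OF u B(1)] k[OF u B(2)] k[OF B(1,2)] x K k0 zero_le_dist[of u p] unfolding f_def
    by (smt (verit))
  from this[OF B(3)] this[OF B(4)] k[OF B(3,4)] show ?thesis by (smt (verit))
qed

text \<open>The coordinates \<open>c\<close> for different \<open>n\<close> need not be compatible.
  So the map is built once, from \<open>p\<close> and a fixed \<open>x\<close>, and compared with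
  the coordinate for a ball large enough for the given pair. The nearly antipodal points
  \<open>l\<close>, \<open>r\<close> make the image reach both directions.\<close>

lemma quasi_isometric_line:
  fixes X :: "'a::metric_space set"
  assumes X: "path_metric_space X" "\<not> bounded X" "p \<in> X"
    and C: "\<And>n. n \<ge> N \<Longrightarrow> \<exists>c :: 'a \<Rightarrow> real.
      (\<forall>u\<in>X. \<forall>v\<in>X. dist p u \<le> n \<longrightarrow> dist p v \<le> n \<longrightarrow> \<bar>dist u v - \<bar>c u - c v\<bar>\<bar> \<le> K) \<and>
      (\<exists>l\<in>X. \<exists>r\<in>X. dist p l = n \<and> dist p r = n \<and> dist l r \<ge> 2 * n - K)"
  shows "quasi_isometric X (UNIV :: real set)"
proof -
  obtain x where x: "x \<in> X" "dist p x = 3 * \<bar>K\<bar> + 1"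
    using unbounded_dist_attains[OF X] by (metis abs_ge_zero add_nonneg_nonneg mult_nonneg_nonneg zero_le_numeral zero_le_one)
  define f where "f = (\<lambda>u. if dist u x < dist u p then dist u p else - dist u p)"
  define A where "A = 4 * dist p x + 7 * \<bar>K\<bar>"
  have f: "\<bar>dist u v - \<bar>f u - f v\<bar>\<bar> \<le> A" if uv: "u \<in> X" "v \<in> X" for u v
  proof -
    define n where "n = max N (max (dist p x) (max (dist p u) (dist p v)))"
    have n: "n \<ge> N" "dist p x \<le> n" "dist p u \<le> n" "dist p v \<le> n" "dist p p \<le> n"
      by (auto simp: n_def intro: max.coboundedI2 order_trans[OF zero_le_dist[of p x]])
    obtain c where "\<And>u v. u \<in> X \<Longrightarrow> v \<in> X \<Longrightarrow> dist p u \<le> n \<Longrightarrow> dist p v \<le> n \<Longrightarrow>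
        \<bar>dist u v - \<bar>c u - c v\<bar>\<bar> \<le> K"
      using C[OF n(1)] by blast
    then have "\<bar>dist u v - \<bar>c u - c v\<bar>\<bar> \<le> \<bar>K\<bar>" if "u \<in> {u\<in>X. dist p u \<le> n}" "v \<in> {u\<in>X. dist p u \<le> n}" for u v
      using that by fastforce
    from signed_dist_coordinate[of "{u\<in>X. dist p u \<le> n}" c "\<bar>K\<bar>" p x u v, OF this]
    show ?thesis using n uv X(3) x by (simp add: f_def A_def)
  qed
  define M where "M = max N (A + \<bar>K\<bar> + 1)"
  have A: "A \<ge> 0" by (simp add: A_def)
  have hit: "\<exists>u\<in>X. \<bar>f u - y\<bar> \<le> M" for y
  proof (cases "\<bar>y\<bar> \<ge> M")
    case True
    define n where "n = \<bar>y\<bar>"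
    have n: "n \<ge> N" "n \<ge> A + \<bar>K\<bar> + 1" using True by (auto simp: n_def M_def)
    obtain l r where lr: "l \<in> X" "r \<in> X" "dist p l = n" "dist p r = n" "dist l r \<ge> 2 * n - K"
      using C[OF n(1)] by blast
    have "f l = n \<or> f l = - n" "f r = n \<or> f r = - n"
      using lr(3,4) by (auto simp: f_def dist_commute)
    moreover have "\<bar>dist l r - \<bar>f l - f r\<bar>\<bar> \<le> A" using f lr by blast
    \<comment> \<open>Equal values would force \<open>dist l r \<le> A\<close>, but it is at least
      \<open>2 * n - K\<close>. So \<open>f l\<close> and \<open>f r\<close> are \<open>n\<close>
      and \<open>- n\<close> in some order.\<close>
    then have "f l \<noteq> f r" using n lr(5) A by auto
    ultimately have "f l = y \<or> f r = y" by (auto simp: n_def)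
    then show ?thesis using lr(1,2) A n by (metis M_def abs_ge_zero add_nonneg_nonneg cancel_comm_monoid_add_class.diff_cancel abs_zero max.coboundedI2 zero_le_one)
  next
    case False
    have "f p = 0" by (simp add: f_def)
    then show ?thesis using False X(3) by force
  qed
  have M: "M \<ge> A" by (simp add: M_def le_max_iff_disj)
  have "infdist y (f ` X) \<le> M" for y
  proof -
    obtain u where "u \<in> X" "\<bar>f u - y\<bar> \<le> M" using hit by blast
    then show ?thesis using infdist_le[of "f u" "f ` X" y] by (simp add: dist_real_def abs_minus_commute)
  qed
  moreover have "\<bar>dist u v - \<bar>f u - f v\<bar>\<bar> \<le> M" if "u \<in> X" "v \<in> X" for u v
    using f[OF that] M by linarith
  ultimately have "quasi_isometry 1 M X (UNIV :: real set) f"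
    unfolding quasi_isometry_def using X(3) by (fastforce simp: dist_real_def abs_le_iff)
  then show ?thesis unfolding quasi_isometric_def by blast
qed

section \<open>Long near-geodesics past the base point, and the dichotomy\<close>

text \<open>A point \<open>q\<close> that escapes a long near-geodesic \<open>g\<close> from
  \<open>p\<close> signals a second direction at \<open>p\<close>. A near-geodesic from
  \<open>q\<close> to a point of \<open>g\<close> can join \<open>g\<close> only around an end of
  \<open>g\<close>, and the far end is out of reach, so it passes near \<open>p\<close>.\<close>

lemma long_near_geodesic_through:
  assumes X: "path_metric_space X" "\<not> bounded X" "p \<in> X" and e: "e > 0"
    and D: "D > 0" and NT: "no_tripods e D X"
    and C: "C \<ge> D + 1"
    and esc: "\<And>g. near_geodesic e X g \<Longrightarrow> g 0 = p \<Longrightarrow>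
      \<exists>q\<in>X. dist p q \<le> r \<and> (\<forall>t\<in>{0..1}. dist q (g t) > C)"
  obtains s \<sigma> where "near_geodesic e X \<sigma>" "s \<in> {0..1}" "dist p (\<sigma> s) \<le> 3 * D + 1 + e"
    "dist p (\<sigma> 0) \<ge> C" "dist p (\<sigma> 1) \<ge> C"
proof -
  \<comment> \<open>\<open>N\<close> is chosen so that every point of \<open>\<sigma>\<close> is at
    least \<open>3 * D + 2 + e\<close> from \<open>z\<close>.\<close>
  define N where "N = 2 * \<bar>r\<bar> + C + 2 * e + 3 * D + 2"
  have N: "N \<ge> C" using e D by (simp add: N_def)
  obtain z where z: "z \<in> X" "dist p z = N"
    using unbounded_dist_attains[OF X] by (smt (verit) C D N)
  obtain g where g: "near_geodesic e X g" "g 0 = p" "g 1 = z"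
    using near_geodesic_exists[OF X(1,3) z(1) e] by blast
  obtain q where q: "q \<in> X" "dist p q \<le> r" "\<And>t. t \<in> {0..1} \<Longrightarrow> dist q (g t) > C"
    using esc[OF g(1,2)] by blast
  obtain tm where tm: "tm \<in> {0..1}" "dist p (g tm) = C"
    using dist_attains[OF near_geodesicD(3)[OF g(1)], of p C] z g N C D by auto
  have "g tm \<in> X" using near_geodesicD(4)[OF g(1)] tm by auto
  then obtain \<sigma> where \<sigma>: "near_geodesic e X \<sigma>" "\<sigma> 0 = q" "\<sigma> 1 = g tm"
    using near_geodesic_exists[OF X(1) q(1) _ e] by blast
  have ne: "path_image g \<noteq> {}" by simp
  \<comment> \<open>A point of \<open>\<sigma>\<close> just outside the \<open>D\<close>-neighbourhood of \<open>g\<close> is close to one end of \<open>g\<close>, and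
    \<open>\<sigma>\<close> is too short to come near \<open>z\<close>.\<close>
  have "infdist (\<sigma> 1) (path_image g) = 0"
    using tm \<sigma>(3) by (intro infdist_zero) (auto simp: path_image_def)
  moreover have "infdist (\<sigma> 0) (path_image g) \<ge> C"
    unfolding infdist_notempty[OF ne] \<sigma>(2) using q(3)
    by (intro cINF_greatest) (auto simp: path_image_def less_imp_le)
  moreover have "continuous_on {0..1} (\<lambda>s. infdist (\<sigma> s) (path_image g))"
    using near_geodesicD(3)[OF \<sigma>(1)] by (intro continuous_intros)
  ultimately obtain s where s: "s \<in> {0..1}" "infdist (\<sigma> s) (path_image g) = D + 1 / 2"
    using IVT2'[of "\<lambda>s. infdist (\<sigma> s) (path_image g)" 1 "D + 1 / 2" 0] C D by auto
  have far: "dist (\<sigma> s) (g t) > D" if "t \<in> {0..1}" for t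
    using infdist_le[of "g t" "path_image g" "\<sigma> s"] that s(2) by (auto simp: path_image_def)
  have "\<exists>y\<in>path_image g. dist (\<sigma> s) y < D + 1"
  proof (rule ccontr)
    assume "\<not> ?thesis"
    then have "D + 1 \<le> infdist (\<sigma> s) (path_image g)"
      unfolding infdist_notempty[OF ne] by (intro cINF_greatest) (auto simp: not_less)
    with s(2) show False by simp
  qed
  then obtain t where t: "t \<in> {0..1}" "dist (\<sigma> s) (g t) < D + 1"
    by (auto simp: path_image_def)
  have sX: "\<sigma> s \<in> X" using near_geodesicD(4)[OF \<sigma>(1)] s by auto
  have "dist p (\<sigma> s) \<le> 3 * D + 1 + e"
  proof -
    have "dist (\<sigma> 0) (\<sigma> s) + dist (\<sigma> s) (\<sigma> 1) \<le> dist (\<sigma> 0) (\<sigma> 1) + e"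
      using near_geodesicD(5)[OF \<sigma>(1), of 0 s 1] s by simp
    then have "dist q (\<sigma> s) \<le> dist q (g tm) + e" unfolding \<sigma> using zero_le_dist[of "\<sigma> s" "g tm"] by linarith
    moreover have "dist q (g tm) \<le> dist p q + dist p (g tm)"
      "dist p z \<le> dist p q + dist q (\<sigma> s) + dist (\<sigma> s) z" by metric+
    ultimately have "dist (\<sigma> s) z \<ge> 3 * D + 2 + e"
      using q(2) tm(2) z(2) by (simp add: N_def abs_if split: if_splits)
    \<comment> \<open>The distance to the end is below \<open>(D + 1) + 2 * D + e\<close>, from the
      distance to \<open>g t\<close> and the detour bound; this excludes \<open>z\<close> and leaves
      \<open>p\<close>.\<close>
    with far_point_behind_ends[OF X(1) NT e g(1) sX far t(1)] t(2)
    show ?thesis using zero_le_dist[of p "g t"] zero_le_dist[of z "g t"] unfolding g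
      by (smt (verit) dist_commute)
  qed
  moreover have "dist p (\<sigma> 0) \<ge> C" using q(3)[of 0] by (simp add: \<sigma> g dist_commute)
  moreover have "dist p (\<sigma> 1) \<ge> C" by (simp add: \<sigma> tm)
  ultimately show thesis using that \<sigma>(1) s(1) by blast
qed

lemma quasi_isometric_if_no_tripods:
  fixes X :: "'a::metric_space set"
  assumes X: "path_metric_space X" "\<not> bounded X" and e: "e > 0"
    and D: "D > 0" and NT: "no_tripods e D X"
  shows "quasi_isometric X ({0..} :: real set) \<or> quasi_isometric X (UNIV :: real set)"
proof -
  obtain p where p: "p \<in> X" using X(2) by fastforce
  show ?thesis
  proof (cases "\<exists>C. \<forall>r. \<exists>g. near_geodesic e X g \<and> g 0 = p \<and>
      (\<forall>q\<in>X. dist p q \<le> r \<longrightarrow> (\<exists>t\<in>{0..1}. dist q (g t) \<le> C))")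
    case True
    then show ?thesis using quasi_isometric_ray[OF X p] by blast
  next
    case False
    define K where "K = 3 * D + 1 + e"
    have "\<exists>c :: 'a \<Rightarrow> real.
      (\<forall>u\<in>X. \<forall>v\<in>X. dist p u \<le> n \<longrightarrow> dist p v \<le> n \<longrightarrow> \<bar>dist u v - \<bar>c u - c v\<bar>\<bar> \<le> 3 * K) \<and>
      (\<exists>l\<in>X. \<exists>r\<in>X. dist p l = n \<and> dist p r = n \<and> dist l r \<ge> 2 * n - 3 * K)" if n: "n \<ge> K" for n
    proof -
      \<comment> \<open>The margin \<open>2 * K\<close> excludes points \<open>u\<close> of the
        \<open>n\<close>-ball behind an end of \<open>\<sigma>\<close>: the route from
        \<open>u\<close> through that end to \<open>\<sigma> s\<close> has length at least
        \<open>n + 3 * K\<close>, while the detour bound allows only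
        \<open>n + 2 * K\<close>.\<close>
      define C where "C = n + 2 * K"
      have K: "K > 0" "K \<ge> D + 1" "K \<ge> 2 * D + e" using D e by (auto simp: K_def)
      obtain r where "\<And>g. near_geodesic e X g \<Longrightarrow> g 0 = p \<Longrightarrow>
          \<exists>q\<in>X. dist p q \<le> r \<and> (\<forall>t\<in>{0..1}. dist q (g t) > C)"
        using False by (metis not_le)
      moreover have "C \<ge> D + 1" using n K by (simp add: C_def)
      ultimately obtain s \<sigma> where \<sigma>: "near_geodesic e X \<sigma>" "s \<in> {0..1}" "dist p (\<sigma> s) \<le> K"
          "dist p (\<sigma> 0) \<ge> C" "dist p (\<sigma> 1) \<ge> C"
        using long_near_geodesic_through[OF X p e D NT] unfolding K_def by metis
      have near: "\<exists>t\<in>{0..1}. dist u (\<sigma> t) \<le> D" if u: "u \<in> X" "dist p u \<le> n" for u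
      proof (rule ccontr)
        assume "\<not> ?thesis"
        then have "\<And>t. t \<in> {0..1} \<Longrightarrow> dist u (\<sigma> t) > D" by (auto simp: not_le)
        from far_point_behind_ends[OF X(1) NT e \<sigma>(1) u(1) this \<sigma>(2)]
        obtain i where i: "i = 0 \<or> i = 1"
          "dist u (\<sigma> i) + dist (\<sigma> i) (\<sigma> s) \<le> dist u (\<sigma> s) + 2 * D + e" by blast
        have "dist p (\<sigma> i) \<ge> C" using i(1) \<sigma> by auto
        moreover have "dist p (\<sigma> i) \<le> dist p u + dist u (\<sigma> i)"
          "dist p (\<sigma> i) \<le> dist p (\<sigma> s) + dist (\<sigma> i) (\<sigma> s)"
          "dist u (\<sigma> s) \<le> dist p u + dist p (\<sigma> s)" by metric+
        ultimately show False using i(2) K \<sigma>(3) u(2) n unfolding C_def by linarith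
      qed
      have "\<bar>dist u v - \<bar>dist (\<sigma> 0) u - dist (\<sigma> 0) v\<bar>\<bar> \<le> 3 * K"
        if uv: "u \<in> X" "v \<in> X" "dist p u \<le> n" "dist p v \<le> n" for u v
      proof -
        obtain s t where "s \<in> {0..1}" "t \<in> {0..1}" "dist u (\<sigma> s) \<le> D" "dist v (\<sigma> t) \<le> D"
          using near[OF uv(1,3)] near[OF uv(2,4)] by blast
        from near_geodesic_dist_le[OF \<sigma>(1) this]
        have "dist u v \<le> \<bar>dist (\<sigma> 0) u - dist (\<sigma> 0) v\<bar> + 3 * K" using K D e by linarith
        moreover have "\<bar>dist (\<sigma> 0) u - dist (\<sigma> 0) v\<bar> \<le> dist u v" by metric
        ultimately show ?thesis using K(1) by linarith
      qed
      moreover have "\<exists>l\<in>X. \<exists>r\<in>X. dist p l = n \<and> dist p r = n \<and> dist l r \<ge> 2 * n - 3 * K"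
      proof -
        note cont = near_geodesicD(3)[OF \<sigma>(1)]
        have "C \<ge> n" using K by (simp add: C_def)
        \<comment> \<open>As \<open>K \<le> n \<le> C\<close>, the distance to \<open>p\<close>
          takes the value \<open>n\<close> on both sides of \<open>\<sigma> s\<close>. Additivity
          through \<open>\<sigma> s\<close> makes the two points nearly antipodal.\<close>
        obtain i where i: "0 \<le> i" "i \<le> s" "dist p (\<sigma> i) = n"
          by (rule dist_attains[of 0 s \<sigma> p n])
            (use \<sigma> n \<open>C \<ge> n\<close> in \<open>auto intro: continuous_on_subset[OF cont]\<close>)
        obtain j where j: "s \<le> j" "j \<le> 1" "dist p (\<sigma> j) = n"
          by (rule dist_attains[of s 1 \<sigma> p n])
            (use \<sigma> n \<open>C \<ge> n\<close> in \<open>auto intro: continuous_on_subset[OF cont]\<close>)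
        have "dist (\<sigma> i) (\<sigma> s) + dist (\<sigma> s) (\<sigma> j) \<le> dist (\<sigma> i) (\<sigma> j) + e"
          using near_geodesicD(5)[OF \<sigma>(1)] i j by auto
        moreover have "dist p (\<sigma> i) \<le> dist p (\<sigma> s) + dist (\<sigma> i) (\<sigma> s)"
          "dist p (\<sigma> j) \<le> dist p (\<sigma> s) + dist (\<sigma> s) (\<sigma> j)" by metric+
        ultimately have "dist (\<sigma> i) (\<sigma> j) \<ge> 2 * n - 3 * K" using i(3) j(3) \<sigma>(3) K D by linarith
        moreover have "\<sigma> i \<in> X" "\<sigma> j \<in> X" using near_geodesicD(4)[OF \<sigma>(1)] i j \<sigma>(2) by auto
        ultimately show ?thesis using i(3) j(3) by blast
      qed
      ultimately show ?thesis by blast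
    qed
    then show ?thesis using quasi_isometric_line[OF X p] by blast
  qed
qed

section \<open>Strict and degenerate triangles in \<open>X\<close>\<close>

lemma strict_triangle_realized:
  assumes "\<not> bounded X" "path_metric_space X"
    "\<not> quasi_isometric X ({0..} :: real set)" "\<not> quasi_isometric X (UNIV :: real set)"
    and abc: "a < b + c" "b < a + c" "c < a + b"
  shows "(a, b, c) \<in> K3 X"
proof (rule ccontr)
  assume n: "(a, b, c) \<notin> K3 X"
  define m where "m = min (b + c - a) (min (a + c - b) (a + b - c))"
  \<comment> \<open>Half of the smallest slack keeps all three inequalities strict after adding
    \<open>e\<close>.\<close>
  define e where "e = m / 2"
  have "m > 0" "m \<le> b + c - a" "m \<le> a + c - b" "m \<le> a + b - c"
    using abc by (auto simp: m_def)
  then have e: "e > 0" "a + e < b + c" "b + e < a + c" "c + e < a + b"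
    unfolding e_def by linarith+
  have "no_tripods e (b + c) X"
    using n e abc by (intro no_tripods_if_not_realized) auto
  then show False
    using quasi_isometric_if_no_tripods[OF assms(2,1) e(1), of "b + c"] abc assms(3,4) by auto
qed

lemma K3_permute:
  assumes "(a, b, c) \<in> K3 X"
  shows "(b, c, a) \<in> K3 X" "(c, a, b) \<in> K3 X"
  using assms unfolding K3_def by blast+

text \<open>Three points on one sufficiently long geodesic segment suffice.\<close>

lemma degenerate_triangle_realized:
  assumes "has_arbitrarily_long_geodesics X" "b \<ge> 0" "c \<ge> 0"
  shows "(b + c, b, c) \<in> K3 X"
proof -
  obtain l S where "l \<ge> b + c" "geodesic_segment X l S"
    using assms(1) unfolding has_arbitrarily_long_geodesics_def by blast
  then obtain s t f where st: "s \<le> t" "t - s \<ge> b + c" and f: "isometric_embedding f {s..t} X"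
    unfolding geodesic_segment_def by auto
  have "s \<in> {s..t}" "s + c \<in> {s..t}" "s + b + c \<in> {s..t}"
    using st assms by auto
  moreover from this have "f s \<in> X" "f (s + c) \<in> X" "f (s + b + c) \<in> X"
    "dist (f s) (f (s + b + c)) = b + c" "dist (f (s + b + c)) (f (s + c)) = b"
    "dist (f (s + c)) (f s) = c"
    using f assms by (auto simp: isometric_embedding_def dist_real_def)
  ultimately show ?thesis by (auto simp: K3_def)
qed

lemma K3_subset_triangle_cone: "K3 X \<subseteq> triangle_cone"
proof clarify
  fix a b c assume "(a, b, c) \<in> K3 X"
  then obtain x y z where "x \<in> X" "y \<in> X" "z \<in> X" "dist x y = a" "dist y z = b" "dist z x = c"
    unfolding K3_def by blast
  then show "(a, b, c) \<in> triangle_cone"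
    unfolding triangle_cone_eq
    using dist_triangle[of x y z] dist_triangle[of y z x] dist_triangle[of z x y]
    by (auto simp: dist_commute)
qed

theorem theorem2:
  fixes X :: "'a::metric_space set"
  assumes "\<not> bounded X"
    and "path_metric_space X"
    and "\<not> quasi_isometric X ({0..} :: real set)"
    and "\<not> quasi_isometric X (UNIV :: real set)"
  shows "interior triangle_cone \<subseteq> K3 X \<and>
    (has_arbitrarily_long_geodesics X \<longrightarrow> K3 X = triangle_cone)"
proof (intro conjI impI)
  show "interior triangle_cone \<subseteq> K3 X"
    using strict_triangle_realized[OF assms] strict_triangle_if_interior by auto
next
  assume L: "has_arbitrarily_long_geodesics X"
  have "(a, b, c) \<in> K3 X" if "(a, b, c) \<in> triangle_cone" for a b c
  proof -
    have t: "0 \<le> a" "0 \<le> b" "0 \<le> c" "a \<le> b + c" "b \<le> c + a" "c \<le> a + b"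
      using that by (auto simp: triangle_cone_eq)
    \<comment> \<open>Degenerate triples lie on three faces of the cone, which
      \<open>K3_permute\<close> exchanges.\<close>
    then consider "a = b + c" | "b = c + a" | "c = a + b" | "a < b + c" "b < a + c" "c < a + b"
      by linarith
    then show ?thesis
    proof cases
      case 1
      then show ?thesis using degenerate_triangle_realized[OF L t(2,3)] by simp
    next
      case 2
      then show ?thesis using K3_permute(2)[OF degenerate_triangle_realized[OF L t(3,1)]] by simp
    next
      case 3
      then show ?thesis using K3_permute(1)[OF degenerate_triangle_realized[OF L t(1,2)]] by simp
    next
      case 4
      then show ?thesis using strict_triangle_realized[OF assms] by blast
    qed
  qed
  then show "K3 X = triangle_cone" using K3_subset_triangle_cone[of X] by auto
qed

end
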